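(* Fix $i\in I$. Then $S(a_i,b_i)\neq\emptyset$ if and only if both of the following hold: (a) $a_{ij}\le \dfrac{b_i}{\sqrt[p]{w}}$ for all $j\in J$; (b) there exists some $j_0\in J$ such that either $b_i^{\,p}<1-w$ or $a_{ij_0}\ge\left(\dfrac{b_i^{\,p}+w-1}{w}\right)^{1/p}$.
   Context: Let $I=\{1,\dots,m\}$ and $J=\{1,\dots,n\}$ with $m,n\ge 1$. Let $A=(a_{ij})_{m\times n}$ be a matrix with entries in $[0,1]$ with $i$-th row $a_i$, and let $b=(b_i)_{m\times 1}$ be a vector with entries in $[0,1]$. Let $w\in(0,1)$ and $p>0$ be real numbers. For $x,y\in[0,1]$ put $\varphi(x,y)=\left(w x^{p}+(1-w)y^{p}\right)^{1/p}$ (weighted power mean). For $x\in[0,1]^n$ put $\varphi(a_i,x)=\max_{j\in J}\varphi(a_{ij},x_j)$ and $S(a_i,b_i)=\{x\in[0,1]^n:\varphi(a_i,x)=b_i\}$. In condition (b), the second alternative is only considered when $b_i^{\,p}\ge 1-w$, so that the root is well defined. *)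

theory Defs
  imports "HOL-Analysis.Analysis"
begin

text \<open>
  Real powers, including the real-order root \<open>w powr (1 / p)\<close>, are rendered by \<open>powr\<close>.
  It is only applied to nonnegative bases, with positive exponents, so that the convention
  \<open>0 powr p = 0\<close> agrees with the usual meaning.
\<close>

definition power_mean :: "real \<Rightarrow> real \<Rightarrow> real \<Rightarrow> real \<Rightarrow> real" where
  "power_mean w p x y = (w * x powr p + (1 - w) * y powr p) powr (1 / p)"

definition max_power_mean :: "real \<Rightarrow> real \<Rightarrow> real ^ 'n \<Rightarrow> real ^ 'n \<Rightarrow> real" where
  "max_power_mean w p a x = Max (range (\<lambda>j. power_mean w p (a $ j) (x $ j)))"

definition solution_set :: "real \<Rightarrow> real \<Rightarrow> real ^ 'n \<Rightarrow> real \<Rightarrow> (real ^ 'n) set" where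
  "solution_set w p a \<beta> = {x. (\<forall>j. x $ j \<in> {0..1}) \<and> max_power_mean w p a x = \<beta>}"

end

theory Submission
  imports Defs
begin

text \<open>
  Raising to the power \<open>p\<close> is an increasing bijection of \<open>[0, \<infinity>)\<close>, and it makes every
  comparison in the problem affine: with \<open>s = w a\<^sup>p\<close> and \<open>t = x\<^sup>p\<close>, the mean of \<open>a\<close> and \<open>x\<close>
  is at most (equal to) \<open>\<beta>\<close> exactly when \<open>s + (1 - w) t\<close> is at most (equal to) \<open>\<beta>\<^sup>p\<close>.  As \<open>x\<close>
  runs through \<open>[0, 1]\<close>, the left side sweeps out the interval \<open>[s, s + (1 - w)]\<close>.  So some
  admissible \<open>x\<close> keeps the mean at most \<open>\<beta>\<close> iff \<open>s \<le> \<beta>\<^sup>p\<close> (and then \<open>x = 0\<close> does), while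
  the value \<open>\<beta>\<close> is reached iff \<open>\<beta>\<^sup>p\<close> lies in that interval
  (\<open>power_mean_hits_iff\<close>).

  A maximum equals \<open>\<beta>\<close> iff all entries are at most \<open>\<beta>\<close> and one reaches it.  The coordinates of
  \<open>x\<close> can be chosen independently, so a solution exists iff \<open>w a\<^sub>j\<^sup>p \<le> \<beta>\<^sup>p\<close> for all \<open>j\<close> and
  \<open>\<beta>\<^sup>p \<le> w a\<^sub>j\<^sup>p + (1 - w)\<close> for some \<open>j\<close>: put the value that reaches \<open>\<beta>\<close> at this \<open>j\<close>, and 0
  elsewhere (\<open>solution_set_nonempty_iff\<close>).  Taking \<open>p\<close>-th roots turns the two inequalities into
  the conditions (a) and (b); the case distinction in (b) only separates off the situation
  in which the second inequality holds for every \<open>a\<^sub>j\<close> and its root would be undefined.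
\<close>

lemma root_powr_le_iff:
  fixes s c p :: real
  assumes "0 \<le> s" "0 \<le> c" "0 < p"
  shows "s powr (1 / p) \<le> c \<longleftrightarrow> s \<le> c powr p"
proof -
  have "s powr (1 / p) \<le> c \<longleftrightarrow> (s powr (1 / p)) powr p \<le> c powr p"
    using assms by (metis linorder_not_le powr_ge_zero powr_less_mono2 powr_mono2 less_imp_le)
  also have "(s powr (1 / p)) powr p = s"
    using assms by (simp add: powr_powr)
  finally show ?thesis .
qed

lemma root_powr_eq_iff:
  fixes s c p :: real
  assumes "0 \<le> s" "0 \<le> c" "0 < p"
  shows "s powr (1 / p) = c \<longleftrightarrow> s = c powr p"
  using assms by (auto simp: powr_powr)

lemma power_mean_le_iff:
  assumes "0 \<le> w" "w \<le> 1" "0 < p" "0 \<le> c"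
  shows "power_mean w p a x \<le> c \<longleftrightarrow> w * a powr p + (1 - w) * x powr p \<le> c powr p"
  unfolding power_mean_def using assms by (intro root_powr_le_iff) auto

lemma power_mean_eq_iff:
  assumes "0 \<le> w" "w \<le> 1" "0 < p" "0 \<le> c"
  shows "power_mean w p a x = c \<longleftrightarrow> w * a powr p + (1 - w) * x powr p = c powr p"
  unfolding power_mean_def using assms by (intro root_powr_eq_iff) auto

text \<open>
  The values \<open>x\<^sup>p\<close> for \<open>x \<in> [0, 1]\<close> fill \<open>[0, 1]\<close>, so the \<open>p\<close>-th powers of the means fill an
  interval of length \<open>1 - w\<close>.  The preimage is explicit because \<open>w < 1\<close> lets the affine
  equation be solved for \<open>x\<^sup>p\<close>.
\<close>

lemma power_mean_hits_iff:
  assumes "0 \<le> w" "w < 1" "0 < p" "0 \<le> c"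
  shows "(\<exists>x\<in>{0..1}. power_mean w p a x = c) \<longleftrightarrow>
    w * a powr p \<le> c powr p \<and> c powr p \<le> w * a powr p + (1 - w)"
proof
  assume "\<exists>x\<in>{0..1}. power_mean w p a x = c"
  then obtain x where x: "0 \<le> x" "x \<le> 1" and "power_mean w p a x = c"
    by auto
  then have eq: "w * a powr p + (1 - w) * x powr p = c powr p"
    using assms by (simp add: power_mean_eq_iff)
  have "x powr p \<le> 1"
    using x assms powr_mono2[of p x 1] by simp
  then have "0 \<le> (1 - w) * x powr p" "(1 - w) * x powr p \<le> 1 - w"
    using assms by (auto intro: mult_left_le)
  with eq show "w * a powr p \<le> c powr p \<and> c powr p \<le> w * a powr p + (1 - w)"
    by linarith
next
  assume bounds: "w * a powr p \<le> c powr p \<and> c powr p \<le> w * a powr p + (1 - w)"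
  define t where "t = (c powr p - w * a powr p) / (1 - w)"
  have t: "0 \<le> t" "t \<le> 1"
    using bounds assms by (auto simp: t_def divide_simps)
  have "t powr (1 / p) \<in> {0..1}"
    using t assms root_powr_le_iff[of t 1 p] by simp
  moreover have "(t powr (1 / p)) powr p = t"
    using t assms by (simp add: powr_powr)
  then have "power_mean w p a (t powr (1 / p)) = c"
    using assms by (simp add: power_mean_eq_iff t_def)
  ultimately show "\<exists>x\<in>{0..1}. power_mean w p a x = c"
    by blast
qed

lemma max_power_mean_eq_iff:
  "max_power_mean w p a x = c \<longleftrightarrow>
    (\<forall>j. power_mean w p (a $ j) (x $ j) \<le> c) \<and> (\<exists>j. power_mean w p (a $ j) (x $ j) = c)"
  unfolding max_power_mean_def by (subst Max_eq_iff) auto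

text \<open>
  Off the coordinate that reaches the maximum, 0 is the safest choice: it minimises the mean.
\<close>

lemma solution_set_nonempty_iff:
  assumes "0 \<le> w" "w < 1" "0 < p" "0 \<le> c"
  shows "solution_set w p a c \<noteq> {} \<longleftrightarrow>
    (\<forall>j. w * (a $ j) powr p \<le> c powr p) \<and>
    (\<exists>j. c powr p \<le> w * (a $ j) powr p + (1 - w))"
proof
  assume "solution_set w p a c \<noteq> {}"
  then obtain x where x: "\<And>j. x $ j \<in> {0..1}"
    and le: "\<And>j. power_mean w p (a $ j) (x $ j) \<le> c"
    and ex: "\<exists>j. power_mean w p (a $ j) (x $ j) = c"
    by (auto simp: solution_set_def max_power_mean_eq_iff)
  have "w * (a $ j) powr p \<le> c powr p" for j
  proof -
    have "w * (a $ j) powr p + (1 - w) * (x $ j) powr p \<le> c powr p"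
      using le[of j] assms by (simp add: power_mean_le_iff)
    moreover have "0 \<le> (1 - w) * (x $ j) powr p"
      using assms by simp
    ultimately show ?thesis by linarith
  qed
  moreover have "\<exists>j. c powr p \<le> w * (a $ j) powr p + (1 - w)"
    using ex x power_mean_hits_iff[OF assms] by blast
  ultimately show "(\<forall>j. w * (a $ j) powr p \<le> c powr p) \<and>
    (\<exists>j. c powr p \<le> w * (a $ j) powr p + (1 - w))"
    by blast
next
  assume R: "(\<forall>j. w * (a $ j) powr p \<le> c powr p) \<and>
    (\<exists>j. c powr p \<le> w * (a $ j) powr p + (1 - w))"
  then obtain k where "c powr p \<le> w * (a $ k) powr p + (1 - w)"
    by blast
  then obtain u where u: "u \<in> {0..1}" "power_mean w p (a $ k) u = c"
    using R power_mean_hits_iff[OF assms, of "a $ k"] by blast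
  define x where "x = (\<chi> j. if j = k then u else 0)"
  have "power_mean w p (a $ j) (x $ j) \<le> c" for j
  proof (cases "j = k")
    case True
    then show ?thesis using u by (simp add: x_def)
  next
    case False
    then show ?thesis using R assms by (simp add: x_def power_mean_le_iff)
  qed
  moreover have "power_mean w p (a $ k) (x $ k) = c"
    using u by (simp add: x_def)
  moreover have "x $ j \<in> {0..1}" for j
    using u by (simp add: x_def)
  ultimately have "x \<in> solution_set w p a c"
    unfolding solution_set_def max_power_mean_eq_iff by blast
  then show "solution_set w p a c \<noteq> {}"
    by blast
qed

theorem theorem1:
  fixes A :: "real ^ 'n ^ 'm" and b :: "real ^ 'm" and w p :: real and i :: 'm
  assumes "\<And>i j. A $ i $ j \<in> {0..1}"
    and "\<And>i. b $ i \<in> {0..1}"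
    and "0 < w" and "w < 1" and "0 < p"
  shows "solution_set w p (row i A) (b $ i) \<noteq> {} \<longleftrightarrow>
    (\<forall>j. A $ i $ j \<le> b $ i / w powr (1 / p)) \<and>
    (\<exists>j0. (b $ i) powr p < 1 - w \<or>
      ((b $ i) powr p \<ge> 1 - w \<and>
        A $ i $ j0 \<ge> (((b $ i) powr p + w - 1) / w) powr (1 / p)))"
proof -
  have A0: "0 \<le> A $ i $ j" for j
    using assms(1)[of i j] by simp
  have b0: "0 \<le> b $ i"
    using assms(2)[of i] by simp
  have upper: "A $ i $ j \<le> b $ i / w powr (1 / p) \<longleftrightarrow>
      w * (A $ i $ j) powr p \<le> (b $ i) powr p" for j
  proof -
    have "A $ i $ j \<le> b $ i / w powr (1 / p) \<longleftrightarrow>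
        (w * (A $ i $ j) powr p) powr (1 / p) \<le> b $ i"
      using A0[of j] assms(3,5) by (simp add: powr_mult powr_powr pos_le_divide_eq mult.commute)
    then show ?thesis
      using b0 assms(3,5) by (simp add: root_powr_le_iff)
  qed
  have lower: "((b $ i) powr p < 1 - w \<or> ((b $ i) powr p \<ge> 1 - w \<and>
        A $ i $ j \<ge> (((b $ i) powr p + w - 1) / w) powr (1 / p))) \<longleftrightarrow>
      (b $ i) powr p \<le> w * (A $ i $ j) powr p + (1 - w)" for j
  proof (cases "(b $ i) powr p < 1 - w")
    case True
    moreover have "0 \<le> w * (A $ i $ j) powr p"
      using assms(3) by simp
    ultimately show ?thesis by linarith
  next
    case False
    then have "(((b $ i) powr p + w - 1) / w) powr (1 / p) \<le> A $ i $ j \<longleftrightarrow>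
        ((b $ i) powr p + w - 1) / w \<le> (A $ i $ j) powr p"
      using A0[of j] assms(3,5) by (intro root_powr_le_iff) auto
    also have "\<dots> \<longleftrightarrow> (b $ i) powr p \<le> w * (A $ i $ j) powr p + (1 - w)"
      using assms(3) by (auto simp: pos_divide_le_eq mult.commute)
    finally show ?thesis
      using False by auto
  qed
  have row: "row i A $ j = A $ i $ j" for j
    by (simp add: row_def)
  show ?thesis
    unfolding upper lower
    using solution_set_nonempty_iff[of w p "b $ i" "row i A"] assms(3-5) b0
    by (simp add: row)
qed

end
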